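(* Let $G_1,G_2$ be isomorphic finite abelian groups and let $\phi:G_2\to G_1$ be an isomorphism. For any nonnegative function $f$ on $G_1$ and any $\chi\in\widehat{G_1}$, we have $$\chi\circ\phi\in\widehat{G_2},\qquad \widehat{\sqrt{f}}(\chi)=\widehat{\sqrt{f\circ\phi}}(\chi\circ\phi).$$ Moreover, $f$ and $f\circ\phi$ share the same matrix $Q_0$, i.e. $Q_0^{f}(\chi,\chi')=Q_0^{f\circ\phi}(\chi\circ\phi,\chi'\circ\phi)$ for all $\chi,\chi'\in\widehat{G_1}$.
   Context: For a finite abelian group $G$, $\widehat{G}$ is its character group. Every $f:G\to\mathbb{C}$ has a unique Fourier expansion $f=\sum_{\chi\in\widehat{G}}\widehat{f}(\chi)\chi$. $\sqrt{f}$ denotes the pointwise nonnegative square root of a nonnegative function $f$. For a nonnegative function $f$ on $G$, the matrix $Q_0=Q_0^{f}$, indexed by $\widehat{G}\times\widehat{G}$, is defined by $Q_0^f(\chi,\chi')=\overline{\widehat{\sqrt{f}}(\chi)}\;\widehat{\sqrt{f}}(\chi')$. The matrices $Q_0^f$ and $Q_0^{f\circ\phi}$ are compared via the identification $\widehat{G_1}\to\widehat{G_2}$, $\chi\mapsto\chi\circ\phi$, of their index sets. *)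

theory Defs
  imports Complex_Main "HOL-Algebra.Group"
begin

definition complex_mult_group :: "complex monoid" where
  "complex_mult_group = \<lparr>carrier = - {0}, mult = (*), one = 1\<rparr>"

text \<open>
  Characters are total HOL functions; requiring them to be \<^const>\<open>extensional\<close> on the carrier
  makes each character be represented by exactly one function, so that equality is equality on
  the group and sums over the character group count every character once.  Accordingly, the
  composition of a character with a map into its group is formed with \<^const>\<open>compose\<close>.
\<close>

definition character_group :: "('a, 'b) monoid_scheme \<Rightarrow> ('a \<Rightarrow> complex) monoid" where
  "character_group G =
    \<lparr>carrier = hom G complex_mult_group \<inter> extensional (carrier G),
     mult = (\<lambda>\<chi> \<psi>. \<lambda>x\<in>carrier G. \<chi> x * \<psi> x),
     one = (\<lambda>x\<in>carrier G. 1)\<rparr>"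

definition is_fourier_expansion ::
  "('a, 'b) monoid_scheme \<Rightarrow> ('a \<Rightarrow> complex) \<Rightarrow> (('a \<Rightarrow> complex) \<Rightarrow> complex) \<Rightarrow> bool" where
  "is_fourier_expansion G f c \<longleftrightarrow>
    (\<forall>x\<in>carrier G. f x = (\<Sum>\<chi>\<in>carrier (character_group G). c \<chi> * \<chi> x))"

text \<open>
  For a finite abelian group every function has exactly one Fourier expansion; the values of
  \<open>c\<close> off the character group are irrelevant, so uniqueness is asked only of the coefficient
  at \<open>\<chi>\<close>.
\<close>

definition fourier_coeff ::
  "('a, 'b) monoid_scheme \<Rightarrow> ('a \<Rightarrow> complex) \<Rightarrow> ('a \<Rightarrow> complex) \<Rightarrow> complex" where
  "fourier_coeff G f \<chi> = (THE z. \<exists>c. is_fourier_expansion G f c \<and> z = c \<chi>)"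

definition sqrt_fun :: "('a \<Rightarrow> real) \<Rightarrow> 'a \<Rightarrow> complex" where
  "sqrt_fun f = (\<lambda>x. complex_of_real (sqrt (f x)))"

definition Q0 ::
  "('a, 'b) monoid_scheme \<Rightarrow> ('a \<Rightarrow> real) \<Rightarrow> ('a \<Rightarrow> complex) \<Rightarrow> ('a \<Rightarrow> complex) \<Rightarrow> complex" where
  "Q0 G f \<chi> \<chi>' = cnj (fourier_coeff G (sqrt_fun f) \<chi>) * fourier_coeff G (sqrt_fun f) \<chi>'"

end

theory Submission
  imports Defs
begin

text \<open>
  The reason is transport of structure: an isomorphism \<open>\<phi>\<close> from \<open>G2\<close> to \<open>G1\<close> makes
  \<open>\<chi> \<mapsto> \<chi> \<circ> \<phi>\<close> a bijection of the character groups, with inverse the pullback along the inverse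
  of \<open>\<phi>\<close> (\<open>bij_betw_pullback_characters\<close>).  Evaluating an expansion of \<open>F\<close> at \<open>\<phi> y\<close> and
  reindexing the sum along this bijection turns it into an expansion of \<open>F \<circ> \<phi>\<close> at \<open>y\<close> with the
  same coefficients, and vice versa (\<open>is_fourier_expansion_pullback_iff\<close>).

  Hence the values that an expansion of \<open>F\<close> can assign to \<open>\<chi>\<close> are exactly those that an expansion
  of \<open>F \<circ> \<phi>\<close> can assign to \<open>\<chi> \<circ> \<phi>\<close>, so the two definite descriptions defining the Fourier
  coefficients describe the same number.  The square root is taken pointwise and so
  commutes with pullback, and \<open>Q0\<close> is built from the coefficients of the square root alone.
\<close>

lemma carrier_character_group:
  "carrier (character_group G) = hom G complex_mult_group \<inter> extensional (carrier G)"
  by (simp add: character_group_def)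

lemma pullback_character_closed:
  assumes "\<phi> \<in> hom H G" and "group H" and "\<chi> \<in> carrier (character_group G)"
  shows "compose (carrier H) \<chi> \<phi> \<in> carrier (character_group H)"
proof -
  interpret H: group H by fact
  have "\<chi> \<circ> \<phi> \<in> hom H complex_mult_group"
    using assms hom_compose [of \<phi> H G \<chi> complex_mult_group]
    by (simp add: carrier_character_group)
  then have "compose (carrier H) \<chi> \<phi> \<in> hom H complex_mult_group"
    by (auto simp: hom_def compose_def Pi_iff)
  then show ?thesis
    by (simp add: carrier_character_group)
qed

text \<open>
  Functions that are extensional on the carrier are recovered from their restrictions to it, so
  pulling back along \<open>\<phi>\<close> and along its inverse cancel as equalities of total functions.
\<close>

lemma bij_betw_pullback_characters:
  assumes "group G" and "group H" and iso: "\<phi> \<in> iso H G"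
  shows "bij_betw (\<lambda>\<chi>. compose (carrier H) \<chi> \<phi>)
           (carrier (character_group G)) (carrier (character_group H))"
proof -
  let ?\<psi> = "inv_into (carrier H) \<phi>"
  have bij: "bij_betw \<phi> (carrier H) (carrier G)" and hom: "\<phi> \<in> hom H G"
    using iso by (auto simp: iso_def)
  have inv_iso: "?\<psi> \<in> iso G H"
    by (rule group.iso_set_sym [OF \<open>group H\<close> iso])
  then have inv_hom: "?\<psi> \<in> hom G H"
    by (simp add: iso_def)
  show ?thesis
  proof (rule bij_betw_byWitness [where f' = "\<lambda>\<chi>. compose (carrier G) \<chi> ?\<psi>"])
    show "\<forall>\<chi>\<in>carrier (character_group G).
        compose (carrier G) (compose (carrier H) \<chi> \<phi>) ?\<psi> = \<chi>"
    proof
      fix \<chi> assume "\<chi> \<in> carrier (character_group G)"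
      then have "\<chi> \<in> extensional (carrier G)"
        by (simp add: carrier_character_group)
      then show "compose (carrier G) (compose (carrier H) \<chi> \<phi>) ?\<psi> = \<chi>"
        using bij_betw_inv_into_right [OF bij] hom_in_carrier [OF inv_hom]
        by (intro extensionalityI [of _ "carrier G"]) (simp_all add: compose_eq)
    qed
    show "\<forall>\<chi>\<in>carrier (character_group H).
        compose (carrier H) (compose (carrier G) \<chi> ?\<psi>) \<phi> = \<chi>"
    proof
      fix \<chi> assume "\<chi> \<in> carrier (character_group H)"
      then have "\<chi> \<in> extensional (carrier H)"
        by (simp add: carrier_character_group)
      then show "compose (carrier H) (compose (carrier G) \<chi> ?\<psi>) \<phi> = \<chi>"
        using bij_betw_inv_into_left [OF bij] hom_in_carrier [OF hom]
        by (intro extensionalityI [of _ "carrier H"]) (simp_all add: compose_eq)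
    qed
    show "(\<lambda>\<chi>. compose (carrier H) \<chi> \<phi>) ` carrier (character_group G)
        \<subseteq> carrier (character_group H)"
      using pullback_character_closed [OF hom \<open>group H\<close>] by blast
    show "(\<lambda>\<chi>. compose (carrier G) \<chi> ?\<psi>) ` carrier (character_group H)
        \<subseteq> carrier (character_group G)"
      using pullback_character_closed [OF inv_hom \<open>group G\<close>] by blast
  qed
qed

text \<open>
  The coefficient families are indexed by the characters of \<open>H\<close>, so that transporting one to \<open>G\<close>
  is composition with the pullback map and its inverse stays out of the statement.
\<close>

lemma is_fourier_expansion_pullback_iff:
  assumes "group G" and "group H" and iso: "\<phi> \<in> iso H G"
  shows "is_fourier_expansion G F (\<lambda>\<chi>. d (compose (carrier H) \<chi> \<phi>))
    \<longleftrightarrow> is_fourier_expansion H (F \<circ> \<phi>) d"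
proof -
  have sums: "(\<Sum>\<chi>\<in>carrier (character_group G). d (compose (carrier H) \<chi> \<phi>) * \<chi> (\<phi> y))
      = (\<Sum>\<chi>\<in>carrier (character_group H). d \<chi> * \<chi> y)" if "y \<in> carrier H" for y
    using sum.reindex_bij_betw [OF bij_betw_pullback_characters [OF assms],
        of "\<lambda>\<chi>. d \<chi> * \<chi> y"] that
    by (simp add: compose_eq)
  have "\<phi> ` carrier H = carrier G"
    using iso by (simp add: iso_def bij_betw_def)
  then have "is_fourier_expansion G F (\<lambda>\<chi>. d (compose (carrier H) \<chi> \<phi>)) \<longleftrightarrow>
      (\<forall>y\<in>carrier H. F (\<phi> y) =
        (\<Sum>\<chi>\<in>carrier (character_group G). d (compose (carrier H) \<chi> \<phi>) * \<chi> (\<phi> y)))"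
    unfolding is_fourier_expansion_def by force
  then show ?thesis
    by (simp add: sums is_fourier_expansion_def)
qed

lemma is_fourier_expansion_cong:
  assumes "\<And>\<chi>. \<chi> \<in> carrier (character_group G) \<Longrightarrow> c \<chi> = d \<chi>"
  shows "is_fourier_expansion G F c \<longleftrightarrow> is_fourier_expansion G F d"
  using assms by (simp add: is_fourier_expansion_def)

lemma fourier_coeff_pullback:
  assumes "group G" and "group H" and iso: "\<phi> \<in> iso H G"
    and \<chi>: "\<chi> \<in> carrier (character_group G)"
  shows "fourier_coeff G F \<chi> = fourier_coeff H (F \<circ> \<phi>) (compose (carrier H) \<chi> \<phi>)"
proof -
  let ?T = "\<lambda>\<chi>. compose (carrier H) \<chi> \<phi>"
  let ?S = "inv_into (carrier (character_group G)) ?T"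
  note pullback_iff = is_fourier_expansion_pullback_iff [OF assms(1-3)]
  have S_T: "?S (?T \<eta>) = \<eta>" if "\<eta> \<in> carrier (character_group G)" for \<eta>
    using bij_betw_inv_into_left [OF bij_betw_pullback_characters [OF assms(1-3)] that] .
  have "(\<exists>c. is_fourier_expansion G F c \<and> z = c \<chi>) \<longleftrightarrow>
      (\<exists>d. is_fourier_expansion H (F \<circ> \<phi>) d \<and> z = d (?T \<chi>))" for z
  proof
    assume "\<exists>c. is_fourier_expansion G F c \<and> z = c \<chi>"
    then obtain c where c: "is_fourier_expansion G F c" "z = c \<chi>"
      by blast
    from c(1) have "is_fourier_expansion G F (\<lambda>\<eta>. c (?S (?T \<eta>)))"
      using is_fourier_expansion_cong [of G "\<lambda>\<eta>. c (?S (?T \<eta>))" c F] by (simp add: S_T)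
    then have "is_fourier_expansion H (F \<circ> \<phi>) (\<lambda>\<eta>. c (?S \<eta>))"
      using pullback_iff [of F "\<lambda>\<eta>. c (?S \<eta>)"] by simp
    moreover have "z = c (?S (?T \<chi>))"
      using c(2) S_T [OF \<chi>] by simp
    ultimately show "\<exists>d. is_fourier_expansion H (F \<circ> \<phi>) d \<and> z = d (?T \<chi>)"
      by blast
  next
    assume "\<exists>d. is_fourier_expansion H (F \<circ> \<phi>) d \<and> z = d (?T \<chi>)"
    then show "\<exists>c. is_fourier_expansion G F c \<and> z = c \<chi>"
      using pullback_iff by blast
  qed
  then show ?thesis
    by (simp add: fourier_coeff_def)
qed

lemma sqrt_fun_comp: "sqrt_fun (f \<circ> \<phi>) = sqrt_fun f \<circ> \<phi>"
  by (simp add: sqrt_fun_def fun_eq_iff)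

theorem proposition3p6:
  fixes G1 :: "('a, 'c) monoid_scheme" and G2 :: "('b, 'd) monoid_scheme"
    and \<phi> :: "'b \<Rightarrow> 'a" and f :: "'a \<Rightarrow> real"
  assumes "comm_group G1" and "finite (carrier G1)"
    and "comm_group G2" and "finite (carrier G2)"
    and "\<phi> \<in> iso G2 G1"
    and "\<forall>x\<in>carrier G1. 0 \<le> f x"
  shows "(\<forall>\<chi>\<in>carrier (character_group G1).
            compose (carrier G2) \<chi> \<phi> \<in> carrier (character_group G2) \<and>
            fourier_coeff G1 (sqrt_fun f) \<chi>
              = fourier_coeff G2 (sqrt_fun (f \<circ> \<phi>)) (compose (carrier G2) \<chi> \<phi>)) \<and>
         (\<forall>\<chi>\<in>carrier (character_group G1). \<forall>\<chi>'\<in>carrier (character_group G1).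
            Q0 G1 f \<chi> \<chi>'
              = Q0 G2 (f \<circ> \<phi>) (compose (carrier G2) \<chi> \<phi>) (compose (carrier G2) \<chi>' \<phi>))"
proof -
  have groups: "group G1" "group G2"
    using assms by (simp_all add: comm_group_def)
  have hom: "\<phi> \<in> hom G2 G1"
    using assms by (simp add: iso_def)
  note closed = pullback_character_closed [OF hom groups(2)]
  have coeff: "fourier_coeff G1 (sqrt_fun f) \<chi>
      = fourier_coeff G2 (sqrt_fun (f \<circ> \<phi>)) (compose (carrier G2) \<chi> \<phi>)"
    if "\<chi> \<in> carrier (character_group G1)" for \<chi>
    using fourier_coeff_pullback [OF groups assms(5) that] by (simp add: sqrt_fun_comp)
  show ?thesis
    by (simp add: closed coeff Q0_def)
qed

end
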